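(* Let $U,V\subseteq\mathbb{R}^n$ be linear subspaces with $V\not\subset U$, let $T=P_VP_U$, and for $v\in V$ write $\bar v=P_{U\cap V}(v)$. For every Borel-measurable $c:V\to\mathbb{R}$ with $c|_{U\cap V}\equiv0$, the map $\Phi_c(v):=v+c(v)\bigl(T(v)-v\bigr)$ satisfies $$\sup_{v\in V,\;v\ne\bar v}\frac{\|\Phi_c(v)-\bar v\|}{\|v-\bar v\|}\ \ge\ \rho_V=\frac{\sin^2\theta_p-\sin^2\theta_F}{\sin^2\theta_p+\sin^2\theta_F},$$ and this bound is attained by $C_T$ (restricted to $V$), which is a parameter-free method of this form. Hence $C_T$ is optimal in the class of all maps $\Phi_c$, even when compared against members that use full prior knowledge of $(\theta_F,\theta_p)$.
   Context: For a linear subspace $W\subseteq\mathbb{R}^n$, $P_W$ is the orthogonal projection onto $W$, $R_W=2P_W-\mathrm{Id}$ and $\operatorname{dist}(x,W)=\|x-P_Wx\|$. $p=\dim V$, $s=\dim(U\cap V)<p$. Principal angles: let $\sigma_1\ge\dots\ge\sigma_p\ge0$ be the singular values of $P_U|_V:V\to\mathbb{R}^n$ and $\theta_k=\arccos\sigma_k$, so $0\le\theta_1\le\dots\le\theta_p\le\pi/2$; the first $s$ are $0$. The Friedrichs angle is $\theta_F:=\theta_{s+1}\in(0,\pi/2]$. A single-step method on $V$ along $T(v)-v$ is a map $\Phi_c:V\to V$, $\Phi_c(v)=v+c(v)(T(v)-v)$, with $c:V\to\mathbb{R}$ Borel-measurable and $c\equiv0$ on $U\cap V$. It is called parameter-free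 if $c(v)$ depends only on the data $(v,P_U(v),P_V(v),\|v\|,\operatorname{dist}(v,U),\operatorname{dist}(v,V))$ associated with the current iterate, that is, on quantities computable from $v$ together with the projections $P_U,P_V$, without explicit dependence on the principal angles of $(U,V)$. Circumcenter: for a finite set $S\subset\mathbb{R}^n$ for which some point $q\in\mathbb{R}^n$ is equidistant from all elements of $S$, $\mathrm{circumcenter}(S):=P_{\mathrm{aff}(S)}(q)$, the orthogonal projection of $q$ onto the affine hull of $S$ (independent of the choice of $q$). $C_T(x):=\mathrm{circumcenter}\{x,R_Ux,R_VR_Ux\}$ (any point of $U\cap V$ is equidistant from the three vertices). *)

theory Defs
  imports "HOL-Analysis.Analysis" "HOL-Library.Multiset"
begin

text \<open>Orthogonal projection onto a nonempty affine set \<open>S\<close>. For a linear subspace the condition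
  says that \<open>x - y\<close> is orthogonal to \<open>S\<close>.\<close>

definition orth_proj :: "'a::euclidean_space set \<Rightarrow> 'a \<Rightarrow> 'a" where
  "orth_proj S x = (THE y. y \<in> S \<and> (\<forall>z\<in>S. orthogonal (x - y) (z - y)))"

definition orth_refl :: "'a::euclidean_space set \<Rightarrow> 'a \<Rightarrow> 'a" where
  "orth_refl W x = 2 *\<^sub>R orth_proj W x - x"

definition proj_dist :: "'a::euclidean_space \<Rightarrow> 'a set \<Rightarrow> real" where
  "proj_dist x W = norm (x - orth_proj W x)"

text \<open>Adjoint of the restriction \<open>A|\<^sub>V\<close> of a linear map, as a map from the whole space into the
  subspace \<open>V\<close>; \<open>gram_eigenspace V A \<mu>\<close> is the \<open>\<mu>\<close>-eigenspace of \<open>(A|\<^sub>V)\<^sup>* A|\<^sub>V\<close> on \<open>V\<close>.\<close>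

definition adjoint_on ::
  "'a::euclidean_space set \<Rightarrow> ('a \<Rightarrow> 'b::euclidean_space) \<Rightarrow> 'b \<Rightarrow> 'a" where
  "adjoint_on V A y = (THE w. w \<in> V \<and> (\<forall>v\<in>V. A v \<bullet> y = v \<bullet> w))"

definition gram_eigenspace ::
  "'a::euclidean_space set \<Rightarrow> ('a \<Rightarrow> 'b::euclidean_space) \<Rightarrow> real \<Rightarrow> 'a set" where
  "gram_eigenspace V A \<mu> = {v \<in> V. adjoint_on V A (A v) = \<mu> *\<^sub>R v}"

text \<open>The singular values of \<open>A|\<^sub>V\<close> are the square roots of the eigenvalues of \<open>(A|\<^sub>V)\<^sup>* A|\<^sub>V\<close>, repeated
  according to multiplicity (geometric, since the operator is self-adjoint) and listed in
  decreasing order.\<close>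

definition singular_values ::
  "'a::euclidean_space set \<Rightarrow> ('a \<Rightarrow> 'b::euclidean_space) \<Rightarrow> real list" where
  "singular_values V A = rev (sorted_list_of_multiset
     (\<Sum>\<sigma> | \<sigma> \<ge> 0 \<and> (\<exists>v \<in> gram_eigenspace V A (\<sigma>\<^sup>2). v \<noteq> 0).
        replicate_mset (dim (gram_eigenspace V A (\<sigma>\<^sup>2))) \<sigma>))"

text \<open>Principal angles are numbered \<open>1, \<dots>, dim V\<close>, whereas lists are indexed from \<open>0\<close>.\<close>

definition principal_angle :: "'a::euclidean_space set \<Rightarrow> 'a set \<Rightarrow> nat \<Rightarrow> real" where
  "principal_angle U V k = arccos (singular_values V (orth_proj U) ! (k - 1))"

definition friedrichs_angle :: "'a::euclidean_space set \<Rightarrow> 'a set \<Rightarrow> real" where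
  "friedrichs_angle U V = principal_angle U V (dim (U \<inter> V) + 1)"

definition max_angle :: "'a::euclidean_space set \<Rightarrow> 'a set \<Rightarrow> real" where
  "max_angle U V = principal_angle U V (dim V)"

definition rho_V :: "'a::euclidean_space set \<Rightarrow> 'a set \<Rightarrow> real" where
  "rho_V U V = ((sin (max_angle U V))\<^sup>2 - (sin (friedrichs_angle U V))\<^sup>2)
             / ((sin (max_angle U V))\<^sup>2 + (sin (friedrichs_angle U V))\<^sup>2)"

definition alt_proj :: "'a::euclidean_space set \<Rightarrow> 'a set \<Rightarrow> 'a \<Rightarrow> 'a" where
  "alt_proj U V v = orth_proj V (orth_proj U v)"

text \<open>A step-size function on \<open>V\<close> is represented by a total function of which only the values on \<open>V\<close>
  are relevant.\<close>

definition step_size :: "'a::euclidean_space set \<Rightarrow> 'a set \<Rightarrow> ('a \<Rightarrow> real) \<Rightarrow> bool" where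
  "step_size U V c \<longleftrightarrow>
     c \<in> borel_measurable (restrict_space borel V) \<and> (\<forall>v \<in> U \<inter> V. c v = 0)"

definition step_map :: "'a::euclidean_space set \<Rightarrow> 'a set \<Rightarrow> ('a \<Rightarrow> real) \<Rightarrow> 'a \<Rightarrow> 'a" where
  "step_map U V c v = v + c v *\<^sub>R (alt_proj U V v - v)"

text \<open>Worst-case one-step contraction factor. It is an extended real, because the supremum is
  infinite for badly chosen step sizes.\<close>

definition worst_rate :: "'a::euclidean_space set \<Rightarrow> 'a set \<Rightarrow> ('a \<Rightarrow> 'a) \<Rightarrow> ereal" where
  "worst_rate U V \<Phi> = (SUP v \<in> {v \<in> V. v \<noteq> orth_proj (U \<inter> V) v}.
     ereal (norm (\<Phi> v - orth_proj (U \<inter> V) v) / norm (v - orth_proj (U \<inter> V) v)))"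

definition circumcenter :: "'a::euclidean_space set \<Rightarrow> 'a" where
  "circumcenter S = orth_proj (affine hull S) (SOME q. \<forall>x\<in>S. \<forall>y\<in>S. dist q x = dist q y)"

definition circ_map :: "'a::euclidean_space set \<Rightarrow> 'a set \<Rightarrow> 'a \<Rightarrow> 'a" where
  "circ_map U V x = circumcenter {x, orth_refl U x, orth_refl V (orth_refl U x)}"

text \<open>The data associated with an iterate. Besides \<open>v\<close>, \<open>P\<^sub>U v\<close>, \<open>P\<^sub>V v\<close>, \<open>\<parallel>v\<parallel>\<close>, \<open>dist(v,U)\<close> and
  \<open>dist(v,V)\<close> it contains \<open>T v = P\<^sub>V (P\<^sub>U v)\<close>, which every map \<open>v + c(v) (T v - v)\<close> evaluates anyway and
  which is computed from \<open>v\<close> by the two projections alone.\<close>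

definition iterate_data ::
  "'a::euclidean_space set \<Rightarrow> 'a set \<Rightarrow> 'a \<Rightarrow> 'a \<times> 'a \<times> 'a \<times> 'a \<times> real \<times> real \<times> real" where
  "iterate_data U V v =
     (v, orth_proj U v, orth_proj V v, alt_proj U V v, norm v, proj_dist v U, proj_dist v V)"

text \<open>A method assigns a map to every pair \<open>(U, V)\<close>. It is parameter-free if its step size is one and
  the same function \<open>F\<close> of the data for all pairs. With \<open>F\<close> allowed to vary with \<open>(U, V)\<close>, every step
  size would qualify, since \<open>v\<close> itself belongs to the data.
  Without \<open>T v\<close> in the data the circumcenter map would not qualify: if \<open>u \<noteq> 0\<close> is the projection of
  \<open>v \<noteq> u\<close> onto \<open>U = span {u}\<close>, then \<open>V = span {v}\<close> and \<open>V = span {u, v}\<close> give the same remaining data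
  but different step sizes.\<close>

definition parameter_free_method ::
  "('a::euclidean_space set \<Rightarrow> 'a set \<Rightarrow> 'a \<Rightarrow> 'a) \<Rightarrow> bool" where
  "parameter_free_method \<Psi> \<longleftrightarrow>
     (\<exists>F. \<forall>U V. subspace U \<and> subspace V \<and> \<not> V \<subseteq> U \<longrightarrow>
        step_size U V (\<lambda>v. F (iterate_data U V v)) \<and>
        (\<forall>v\<in>V. \<Psi> U V v = step_map U V (\<lambda>v. F (iterate_data U V v)) v))"

end

theory Submission
  imports Defs
begin

text \<open>On \<open>V\<close> the operator \<open>A = Id - T\<close>, with \<open>T = P\<^sub>V P\<^sub>U\<close>, is self-adjoint and positive semidefinite, its
  kernel is \<open>U \<inter> V\<close>, and its eigenvalues are the squared sines of the principal angles. On the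
  orthogonal complement of \<open>U \<inter> V\<close> in \<open>V\<close> its spectrum therefore has the least element
  \<open>a = sin\<^sup>2 \<theta>\<^sub>F > 0\<close> and the greatest element \<open>b = sin\<^sup>2 \<theta>\<^sub>p\<close> (\<open>principal_eigenbasis\<close>, from the spectral
  theorem \<open>selfadjoint_eigenbasis\<close>). With \<open>w = v - q\<close>, where \<open>q\<close> is the projection of \<open>v\<close> onto \<open>U \<inter> V\<close>, a
  step of size \<open>c(v)\<close> replaces the error \<open>w\<close> by \<open>w - c(v) A w\<close>.

  For the lower bound a single starting point suffices. At \<open>w = \<surd>b e\<^sub>F + \<surd>a e\<^sub>p\<close>, built from unit
  eigenvectors for \<open>a\<close> and \<open>b\<close>, every scalar \<open>c\<close> gives \<open>\<parallel>w - c A w\<parallel> \<ge> (b - a) / (b + a) \<parallel>w\<parallel>\<close>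
  (\<open>kantorovich_extremal_vector\<close>), so it does not matter how \<open>c(v)\<close> is chosen. If \<open>a = b\<close>, the bound
  is 0 and any eigenvector serves.

  For the upper bound, the circumcenter of \<open>v\<close>, \<open>R\<^sub>U v\<close>, \<open>R\<^sub>V R\<^sub>U v\<close> turns out to be the point of the line
  \<open>v + \<real> A v\<close> closest to \<open>q\<close> (\<open>circ_map_eq_step_map\<close>). It is thus at least as good as the step of
  fixed size \<open>2 / (a + b)\<close>, whose contraction factor is \<open>(b - a) / (b + a)\<close>
  (\<open>relaxed_step_contraction\<close>). Its own step size \<open>\<langle>v, A v\<rangle> / \<parallel>A v\<parallel>\<^sup>2\<close> involves neither angle.\<close>

section \<open>Orthogonal projections\<close>

lemma orth_proj_eqI:
  assumes "y \<in> S" and "\<And>z. z \<in> S \<Longrightarrow> (x - y) \<bullet> (z - y) = 0"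
  shows "orth_proj S x = y"
  unfolding orth_proj_def
proof (rule the_equality)
  show "y \<in> S \<and> (\<forall>z\<in>S. orthogonal (x - y) (z - y))"
    using assms by (simp add: orthogonal_def)
next
  fix y' assume y': "y' \<in> S \<and> (\<forall>z\<in>S. orthogonal (x - y') (z - y'))"
  then have "(x - y) \<bullet> (y' - y) = 0" "(x - y') \<bullet> (y - y') = 0"
    using assms by (auto simp: orthogonal_def)
  then have "(y' - y) \<bullet> (y' - y) = 0"
    by (simp add: inner_diff_left inner_diff_right inner_commute)
  then show "y' = y" by simp
qed

lemma orth_proj_subspace_eqI:
  assumes "subspace S" and "y \<in> S" and "\<And>z. z \<in> S \<Longrightarrow> (x - y) \<bullet> z = 0"
  shows "orth_proj S x = y"
  using assms by (intro orth_proj_eqI) (auto simp: subspace_diff)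

lemma orth_proj_subspace:
  assumes "subspace S"
  shows orth_proj_in: "orth_proj S x \<in> S"
    and orth_proj_residual: "z \<in> S \<Longrightarrow> (x - orth_proj S x) \<bullet> z = 0"
proof -
  obtain y r where "y \<in> span S" "\<And>w. w \<in> span S \<Longrightarrow> orthogonal r w" "x = y + r"
    using orthogonal_subspace_decomp_exists[of S x] by metis
  moreover have "span S = S" using assms by (simp add: span_eq_iff)
  ultimately have "y \<in> S" and r: "\<And>w. w \<in> S \<Longrightarrow> (x - y) \<bullet> w = 0"
    by (auto simp: orthogonal_def)
  then have "orth_proj S x = y"
    using orth_proj_subspace_eqI[OF assms] by blast
  then show "orth_proj S x \<in> S" and "z \<in> S \<Longrightarrow> (x - orth_proj S x) \<bullet> z = 0"
    using \<open>y \<in> S\<close> r by auto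
qed

lemma orth_proj_inner:
  assumes "subspace S" and "z \<in> S"
  shows "orth_proj S x \<bullet> z = x \<bullet> z"
  using orth_proj_residual[OF assms, of x] by (simp add: inner_diff_left)

lemma orth_proj_id: "subspace S \<Longrightarrow> x \<in> S \<Longrightarrow> orth_proj S x = x"
  by (rule orth_proj_subspace_eqI) auto

lemma linear_orth_proj:
  assumes "subspace S"
  shows "linear (orth_proj S)"
proof
  show "orth_proj S (x + y) = orth_proj S x + orth_proj S y" for x y
    using assms
    by (intro orth_proj_subspace_eqI)
       (auto simp: orth_proj_in subspace_add inner_diff_left inner_add_left orth_proj_inner)
  show "orth_proj S (r *\<^sub>R x) = r *\<^sub>R orth_proj S x" for r x
    using assms
    by (intro orth_proj_subspace_eqI)
       (auto simp: orth_proj_in subspace_scale inner_diff_left orth_proj_inner)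
qed

lemma orth_proj_selfadjoint:
  assumes "subspace S"
  shows "orth_proj S x \<bullet> y = x \<bullet> orth_proj S y"
proof -
  have "orth_proj S x \<bullet> y = orth_proj S y \<bullet> orth_proj S x"
    using orth_proj_inner[OF assms orth_proj_in[OF assms], of y x] by (simp add: inner_commute)
  also have "\<dots> = x \<bullet> orth_proj S y"
    using orth_proj_inner[OF assms orth_proj_in[OF assms], of x y] by (simp add: inner_commute)
  finally show ?thesis .
qed

lemma alt_proj_in: "subspace V \<Longrightarrow> alt_proj U V x \<in> V"
  by (simp add: alt_proj_def orth_proj_in)

lemma linear_alt_proj:
  assumes "subspace U" and "subspace V"
  shows "linear (alt_proj U V)"
  using linear_compose[OF linear_orth_proj linear_orth_proj, OF assms]
  by (simp add: alt_proj_def[abs_def] o_def)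

lemma alt_proj_inner:
  assumes "subspace U" and "subspace V" and "y \<in> V"
  shows "alt_proj U V x \<bullet> y = orth_proj U x \<bullet> orth_proj U y"
proof -
  have "alt_proj U V x \<bullet> y = orth_proj U x \<bullet> y"
    by (simp add: alt_proj_def orth_proj_inner assms)
  also have "\<dots> = orth_proj U (orth_proj U x) \<bullet> y"
    by (simp add: orth_proj_id orth_proj_in assms)
  also have "\<dots> = orth_proj U x \<bullet> orth_proj U y"
    by (rule orth_proj_selfadjoint[OF assms(1)])
  finally show ?thesis .
qed

lemma alt_proj_selfadjoint:
  assumes "subspace U" and "subspace V" and "x \<in> V" and "y \<in> V"
  shows "alt_proj U V x \<bullet> y = x \<bullet> alt_proj U V y"
  using alt_proj_inner[OF assms(1,2,4), of x] alt_proj_inner[OF assms(1,2,3), of y]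
  by (simp add: inner_commute)

text \<open>For \<open>v \<in> V\<close> Pythagoras gives \<open>\<langle>v, v - T v\<rangle> = dist(v, U)\<^sup>2\<close>, so the operator \<open>Id - T\<close> is positive
  semidefinite on \<open>V\<close> and vanishes precisely at the points of \<open>U\<close>.\<close>

lemma inner_alt_proj_residual:
  assumes "subspace U" and "subspace V" and "v \<in> V"
  shows "v \<bullet> (v - alt_proj U V v) = (proj_dist v U)\<^sup>2"
proof -
  have "v \<bullet> alt_proj U V v = orth_proj U v \<bullet> orth_proj U v"
    using alt_proj_inner[OF assms, of v] by (simp add: inner_commute)
  moreover have "v \<bullet> orth_proj U v = orth_proj U v \<bullet> orth_proj U v"
    using orth_proj_inner[OF assms(1) orth_proj_in[OF assms(1)], of v v] by simp
  ultimately show ?thesis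
    by (simp add: proj_dist_def power2_norm_eq_inner inner_diff_left inner_diff_right inner_commute)
qed

lemma alt_proj_fixed_iff:
  assumes "subspace U" and "subspace V" and "v \<in> V"
  shows "alt_proj U V v = v \<longleftrightarrow> v \<in> U"
proof
  assume "alt_proj U V v = v"
  then have "v = orth_proj U v"
    using inner_alt_proj_residual[OF assms] by (simp add: proj_dist_def)
  then show "v \<in> U" using orth_proj_in[OF assms(1), of v] by simp
qed (simp add: alt_proj_def orth_proj_id assms)

section \<open>Eigenbases of self-adjoint operators on a subspace\<close>

text \<open>A maximiser \<open>v\<close> of the Rayleigh quotient over the unit sphere of \<open>V\<close> is an eigenvector: with \<open>m\<close>
  the maximum, the operator \<open>m Id - f\<close> is positive semidefinite on \<open>V\<close>, and its form vanishes at \<open>v\<close>.\<close>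

lemma rayleigh_maximizer_eigenvector:
  fixes f :: "'a::euclidean_space \<Rightarrow> 'a"
  assumes V: "subspace V" and f: "linear f" and inv: "\<And>x. x \<in> V \<Longrightarrow> f x \<in> V"
    and sym: "\<And>x y. x \<in> V \<Longrightarrow> y \<in> V \<Longrightarrow> f x \<bullet> y = x \<bullet> f y"
    and ne: "V \<noteq> {0}"
  obtains v where "v \<in> V" "norm v = 1" "f v = (f v \<bullet> v) *\<^sub>R v"
proof -
  let ?S = "V \<inter> sphere 0 1"
  obtain x where x: "x \<in> V" "x \<noteq> 0" using ne V subspace_0 by fastforce
  have "x /\<^sub>R norm x \<in> ?S" using x V by (auto simp: subspace_scale)
  then have "?S \<noteq> {}" by blast
  moreover have "compact ?S" by (simp add: V closed_subspace closed_Int_compact)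
  moreover have "continuous_on ?S (\<lambda>x. f x \<bullet> x)"
    by (intro continuous_intros linear_continuous_on linear_conv_bounded_linear[THEN iffD1] f)
  ultimately obtain v where v: "v \<in> ?S" and max: "\<And>y. y \<in> ?S \<Longrightarrow> f y \<bullet> y \<le> f v \<bullet> v"
    using continuous_attains_sup[of ?S "\<lambda>x. f x \<bullet> x"] by blast
  define m where "m = f v \<bullet> v"
  define g where "g y = m *\<^sub>R y - f y" for y
  have vv: "v \<in> V" "norm v = 1" "v \<bullet> v = 1" using v by (auto simp: norm_eq_1)
  have pos: "0 \<le> g y \<bullet> y" if "y \<in> V" for y
  proof (cases "y = 0")
    case False
    let ?u = "y /\<^sub>R norm y"
    have "?u \<in> ?S" using that False V by (auto simp: subspace_scale)
    then have "f ?u \<bullet> ?u \<le> m" using max m_def by blast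
    moreover have "f ?u \<bullet> ?u = (f y \<bullet> y) / (norm y)\<^sup>2"
      by (simp add: linear_scale[OF f] power2_eq_square divide_inverse)
    ultimately show ?thesis
      using False by (simp add: g_def inner_diff_left power2_norm_eq_inner divide_le_eq)
  qed simp
  have gV: "g v \<in> V" using vv V inv by (simp add: g_def subspace_diff subspace_scale)
  have g0: "g v \<bullet> v = 0" by (simp add: g_def m_def inner_diff_left vv)
  \<comment> \<open>The form \<open>g\<close> is nonnegative along the line \<open>v + t g(v)\<close> and vanishes at \<open>t = 0\<close>, so its linear
    term \<open>2 t \<parallel>g v\<parallel>\<^sup>2\<close> must be zero.\<close>
  have "g v = 0"
  proof (rule ccontr)
    assume "g v \<noteq> 0"
    define q where "q = g v \<bullet> g v"
    define k where "k = g (g v) \<bullet> g v"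
    have q: "q > 0" using \<open>g v \<noteq> 0\<close> by (simp add: q_def)
    have k: "k \<ge> 0" using pos gV by (simp add: k_def)
    have line: "0 \<le> 2 * t * q + t\<^sup>2 * k" for t
    proof -
      have "g (v + t *\<^sub>R g v) = g v + t *\<^sub>R g (g v)"
        by (simp add: g_def linear_add[OF f] linear_scale[OF f] linear_diff[OF f] algebra_simps)
      moreover have "g (g v) \<bullet> v = q"
        using sym[OF gV vv(1)] by (simp add: q_def g_def inner_diff_left inner_diff_right)
      ultimately have "g (v + t *\<^sub>R g v) \<bullet> (v + t *\<^sub>R g v) = 2 * t * q + t\<^sup>2 * k"
        using g0 by (simp add: inner_add_left inner_add_right q_def[symmetric] k_def[symmetric]
            power2_eq_square algebra_simps)
      moreover have "v + t *\<^sub>R g v \<in> V" using vv gV V by (simp add: subspace_add subspace_scale)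
      ultimately show ?thesis using pos by metis
    qed
    \<comment> \<open>The denominator \<open>k + 1\<close> instead of \<open>k\<close> also covers \<open>k = 0\<close>.\<close>
    have "2 * (- q / (k + 1)) * q + (- q / (k + 1))\<^sup>2 * k = q\<^sup>2 * (- k - 2) / (k + 1)\<^sup>2"
      using k by (simp add: divide_simps power2_eq_square) (simp add: algebra_simps)
    moreover have "q\<^sup>2 * (- k - 2) / (k + 1)\<^sup>2 < 0"
      using q k by (intro divide_neg_pos mult_pos_neg) auto
    ultimately show False using line[of "- q / (k + 1)"] by linarith
  qed
  then have "f v = (f v \<bullet> v) *\<^sub>R v" by (simp add: g_def m_def)
  then show thesis using that vv by blast
qed

text \<open>The spectral theorem. The orthogonal complement of an eigenvector in \<open>V\<close> is invariant and has
  smaller dimension. The eigenvalue of a unit eigenvector \<open>b\<close> is \<open>f b \<bullet> b\<close>.\<close>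

lemma selfadjoint_eigenbasis:
  fixes f :: "'a::euclidean_space \<Rightarrow> 'a"
  assumes "subspace V" and "linear f" and "\<And>x. x \<in> V \<Longrightarrow> f x \<in> V"
    and "\<And>x y. x \<in> V \<Longrightarrow> y \<in> V \<Longrightarrow> f x \<bullet> y = x \<bullet> f y"
  shows "\<exists>B. finite B \<and> pairwise orthogonal B \<and> span B = V
    \<and> (\<forall>b\<in>B. norm b = 1 \<and> f b = (f b \<bullet> b) *\<^sub>R b)"
  using assms
proof (induction "dim V" arbitrary: V rule: less_induct)
  case less
  show ?case
  proof (cases "V = {0}")
    case True
    then show ?thesis by (intro exI[of _ "{}"]) (auto simp: pairwise_def)
  next
    case False
    obtain v where v: "v \<in> V" "norm v = 1" "f v = (f v \<bullet> v) *\<^sub>R v"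
      using rayleigh_maximizer_eigenvector[OF less.prems False] by blast
    have vv: "v \<bullet> v = 1" using v by (simp add: norm_eq_1)
    define W where "W = {x \<in> V. v \<bullet> x = 0}"
    have W: "subspace W"
      using less.prems(1) subspace_hyperplane[of v] unfolding W_def
      by (auto simp: subspace_def inner_add_right)
    have "v \<notin> W" by (simp add: W_def vv)
    moreover have "W \<subseteq> V" by (auto simp: W_def)
    ultimately have "W \<subset> V" using v by blast
    then have "dim W < dim V" using W less.prems(1) by (metis dim_psubset span_eq_iff)
    moreover have "f x \<in> W" if "x \<in> W" for x
    proof -
      have "v \<bullet> f x = f v \<bullet> x" using that v less.prems(4) by (auto simp: W_def)
      also have "\<dots> = (f v \<bullet> v) * (v \<bullet> x)" by (subst v(3)) simp
      finally show ?thesis using that less.prems(3) by (simp add: W_def)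
    qed
    moreover have "f x \<bullet> y = x \<bullet> f y" if "x \<in> W" "y \<in> W" for x y
      using that less.prems(4) by (auto simp: W_def)
    ultimately obtain B where B: "finite B" "pairwise orthogonal B" "span B = W"
      "\<forall>b\<in>B. norm b = 1 \<and> f b = (f b \<bullet> b) *\<^sub>R b"
      using less.hyps[OF _ W less.prems(2)] by blast
    have "B \<subseteq> W" using B(3) span_superset by blast
    then have "pairwise orthogonal (insert v B)"
      using B(2) by (intro pairwise_orthogonal_insert) (auto simp: W_def orthogonal_def)
    moreover have "span (insert v B) = V"
    proof
      show "span (insert v B) \<subseteq> V"
        using v \<open>B \<subseteq> W\<close> less.prems(1) by (intro span_minimal) (auto simp: W_def)
      show "V \<subseteq> span (insert v B)"
      proof
        fix x assume "x \<in> V"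
        then have "x - (v \<bullet> x) *\<^sub>R v \<in> W"
          using v vv less.prems(1) by (simp add: W_def subspace_diff subspace_scale inner_diff_right)
        then show "x \<in> span (insert v B)" using B(3) span_breakdown_eq by blast
      qed
    qed
    ultimately show ?thesis using B v by (intro exI[of _ "insert v B"]) auto
  qed
qed

lemma orthonormal_independent:
  assumes "pairwise orthogonal B" and "\<And>b. b \<in> B \<Longrightarrow> norm b = 1"
  shows "independent B"
  using assms by (intro pairwise_orthogonal_independent) fastforce+

lemma eigenspace_eq_span:
  fixes f :: "'a::euclidean_space \<Rightarrow> 'a"
  assumes f: "linear f" and sym: "\<And>x y. x \<in> V \<Longrightarrow> y \<in> V \<Longrightarrow> f x \<bullet> y = x \<bullet> f y"
    and B: "finite B" "pairwise orthogonal B" "span B = V"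
      "\<And>b. b \<in> B \<Longrightarrow> norm b = 1" "\<And>b. b \<in> B \<Longrightarrow> f b = l b *\<^sub>R b"
  shows "{v \<in> V. f v = \<mu> *\<^sub>R v} = span {b \<in> B. l b = \<mu>}" (is "?E = span ?C")
proof
  have sub: "subspace ?E"
    using B(3) by (auto simp: subspace_def linear_add[OF f] linear_scale[OF f] linear_0[OF f]
        scaleR_add_right span_add span_scale span_zero)
  have "?C \<subseteq> ?E" using B(3,5) span_superset by blast
  then show "span ?C \<subseteq> ?E" using sub by (rule span_minimal)
next
  show "?E \<subseteq> span ?C"
  proof
    fix v assume v: "v \<in> ?E"
    have zero: "v \<bullet> b = 0" if "b \<in> B" "l b \<noteq> \<mu>" for b
    proof -
      have "f v \<bullet> b = v \<bullet> f b" using sym v that B(3) span_base by blast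
      then have "\<mu> * (v \<bullet> b) = l b * (v \<bullet> b)" using v that B(5) by simp
      then show ?thesis using that by simp
    qed
    have "v = (\<Sum>b\<in>B. (v \<bullet> b) *\<^sub>R b)"
      using v B by (intro orthonormal_basis_expand[symmetric]) auto
    also have "\<dots> = (\<Sum>b\<in>?C. (v \<bullet> b) *\<^sub>R b)"
      by (rule sum.mono_neutral_right) (use B zero in auto)
    also have "\<dots> \<in> span ?C" by (intro span_sum span_scale span_base)
    finally show "v \<in> span ?C" .
  qed
qed

section \<open>Principal angles as eigenvalues\<close>

lemma gram_eigenspace_orth_proj:
  assumes "subspace U" and "subspace V"
  shows "gram_eigenspace V (orth_proj U) \<mu> = {v \<in> V. alt_proj U V v = \<mu> *\<^sub>R v}"
proof -
  have "adjoint_on V (orth_proj U) (orth_proj U v) = alt_proj U V v" for v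
    unfolding adjoint_on_def
  proof (rule the_equality)
    show *: "alt_proj U V v \<in> V \<and> (\<forall>x\<in>V. orth_proj U x \<bullet> orth_proj U v = x \<bullet> alt_proj U V v)"
      using assms alt_proj_inner[OF assms, of _ v] by (auto simp: alt_proj_in inner_commute)
    fix w assume w: "w \<in> V \<and> (\<forall>x\<in>V. orth_proj U x \<bullet> orth_proj U v = x \<bullet> w)"
    let ?d = "w - alt_proj U V v"
    have "?d \<in> V" using w * assms by (simp add: subspace_diff)
    then have "?d \<bullet> ?d = 0" using w * by (metis inner_diff_right right_minus_eq)
    then show "w = alt_proj U V v" by simp
  qed
  then show ?thesis by (simp add: gram_eigenspace_def)
qed

lemma image_mset_mset_set_eq_sum:
  assumes "finite B"
  shows "image_mset f (mset_set B) = (\<Sum>y\<in>f ` B. replicate_mset (card {b \<in> B. f b = y}) y)"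
proof (rule multiset_eqI)
  fix z
  have "count (image_mset f (mset_set B)) z = card {b \<in> B. f b = z}"
    using assms by (simp add: count_image_mset' eq_commute[of z])
  also have "\<dots> = (if z \<in> f ` B then card {b \<in> B. f b = z} else 0)"
    using assms by auto
  also have "\<dots> = count (\<Sum>y\<in>f ` B. replicate_mset (card {b \<in> B. f b = y}) y) z"
    using assms by (simp add: count_sum sum.delta)
  finally show "count (image_mset f (mset_set B)) z
      = count (\<Sum>y\<in>f ` B. replicate_mset (card {b \<in> B. f b = y}) y) z" .
qed

text \<open>By orthonormality the dimension of the eigenspace for \<open>\<sigma>\<^sup>2\<close> is the number of basis vectors with
  this eigenvalue, so the geometric multiplicities count every basis vector once.\<close>

lemma singular_values_eigenbasis:
  assumes U: "subspace U" and V: "subspace V"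
    and B: "finite B" "pairwise orthogonal B" "span B = V"
      "\<And>b. b \<in> B \<Longrightarrow> norm b = 1" "\<And>b. b \<in> B \<Longrightarrow> alt_proj U V b = l b *\<^sub>R b"
    and l: "\<And>b. b \<in> B \<Longrightarrow> 0 \<le> l b"
  shows "singular_values V (orth_proj U)
    = rev (sorted_list_of_multiset (image_mset (\<lambda>b. sqrt (l b)) (mset_set B)))"
proof -
  let ?E = "\<lambda>\<sigma>::real. gram_eigenspace V (orth_proj U) (\<sigma>\<^sup>2)"
  have ind: "independent B" using orthonormal_independent B(2,4) by blast
  have E: "?E \<sigma> = span {b \<in> B. sqrt (l b) = \<sigma>}" if "\<sigma> \<ge> 0" for \<sigma>
  proof -
    have "{b \<in> B. l b = \<sigma>\<^sup>2} = {b \<in> B. sqrt (l b) = \<sigma>}" using l that by auto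
    moreover have "?E \<sigma> = span {b \<in> B. l b = \<sigma>\<^sup>2}"
      using eigenspace_eq_span[OF linear_alt_proj[OF U V] alt_proj_selfadjoint[OF U V] B]
      by (simp add: gram_eigenspace_orth_proj[OF U V])
    ultimately show ?thesis by simp
  qed
  have dimE: "dim (?E \<sigma>) = card {b \<in> B. sqrt (l b) = \<sigma>}" if "\<sigma> \<ge> 0" for \<sigma>
    using dim_eq_card_independent[OF independent_mono[OF ind]] E[OF that] by simp
  have "{\<sigma>. \<sigma> \<ge> 0 \<and> (\<exists>v \<in> ?E \<sigma>. v \<noteq> 0)} = (\<lambda>b. sqrt (l b)) ` B" (is "?I = ?J")
  proof
    show "?I \<subseteq> ?J"
    proof
      fix \<sigma> assume "\<sigma> \<in> ?I"
      then obtain v where v: "\<sigma> \<ge> 0" "v \<in> ?E \<sigma>" "v \<noteq> 0" by auto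
      then have "v \<in> span {b \<in> B. sqrt (l b) = \<sigma>}" using E by blast
      then have "{b \<in> B. sqrt (l b) = \<sigma>} \<noteq> {}" using v(3) by (metis span_empty singletonD)
      then show "\<sigma> \<in> ?J" by auto
    qed
    show "?J \<subseteq> ?I"
    proof
      fix \<sigma> assume "\<sigma> \<in> ?J"
      then obtain b where b: "b \<in> B" "\<sigma> = sqrt (l b)" by auto
      then have s: "\<sigma> \<ge> 0" using l by simp
      have "b \<in> ?E \<sigma>" unfolding E[OF s] using b by (intro span_base) auto
      moreover have "b \<noteq> 0" using B(4) b by force
      ultimately show "\<sigma> \<in> ?I" using s by blast
    qed
  qed
  then have "(\<Sum>\<sigma> | \<sigma> \<ge> 0 \<and> (\<exists>v \<in> ?E \<sigma>. v \<noteq> 0). replicate_mset (dim (?E \<sigma>)) \<sigma>)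
      = (\<Sum>\<sigma>\<in>?J. replicate_mset (dim (?E \<sigma>)) \<sigma>)" by simp
  also have "\<dots> = (\<Sum>\<sigma>\<in>?J. replicate_mset (card {b \<in> B. sqrt (l b) = \<sigma>}) \<sigma>)"
  proof (rule sum.cong)
    fix \<sigma> assume "\<sigma> \<in> ?J"
    then have "\<sigma> \<ge> 0" using l by auto
    then show "replicate_mset (dim (?E \<sigma>)) \<sigma> = replicate_mset (card {b \<in> B. sqrt (l b) = \<sigma>}) \<sigma>"
      by (simp only: dimE)
  qed simp
  also have "\<dots> = image_mset (\<lambda>b. sqrt (l b)) (mset_set B)"
    by (rule image_mset_mset_set_eq_sum[OF B(1), symmetric])
  finally show ?thesis by (simp add: singular_values_def)
qed

text \<open>Separates the copies of the top singular value 1, which belong to \<open>U \<inter> V\<close>, from the others.\<close>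

lemma sorted_list_of_multiset_plus_replicate:
  assumes "\<And>x. x \<in># N \<Longrightarrow> x \<le> m"
  shows "sorted_list_of_multiset (N + replicate_mset s m) = sorted_list_of_multiset N @ replicate s m"
proof -
  let ?ys = "sorted_list_of_multiset N @ replicate s m"
  have "mset ?ys = N + replicate_mset s m" by simp
  moreover have "sorted ?ys"
    using assms by (auto simp: sorted_append)
  ultimately show ?thesis
    by (metis sorted_list_of_multiset_mset sorted_sort_id)
qed

text \<open>The eigenvalues of \<open>Id - T\<close> on \<open>V\<close> are the squared sines of the principal angles. Eigenvalue 0
  has eigenspace \<open>U \<inter> V\<close> and so accounts for the first \<open>dim (U \<inter> V)\<close> angles; the next angle
  therefore gives the smallest nonzero eigenvalue, and the last angle gives the largest one.\<close>

lemma principal_eigenbasis: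
  assumes U: "subspace U" and V: "subspace V" and VU: "\<not> V \<subseteq> U"
  obtains B r e\<^sub>F e\<^sub>p where "finite B" "pairwise orthogonal B" "span B = V"
    "\<And>b. b \<in> B \<Longrightarrow> norm b = 1"
    "\<And>b. b \<in> B \<Longrightarrow> alt_proj U V b = b - r b *\<^sub>R b"
    "\<And>b. b \<in> B \<Longrightarrow> b \<notin> U \<Longrightarrow>
       (sin (friedrichs_angle U V))\<^sup>2 \<le> r b \<and> r b \<le> (sin (max_angle U V))\<^sup>2"
    "e\<^sub>F \<in> B" "e\<^sub>F \<notin> U" "r e\<^sub>F = (sin (friedrichs_angle U V))\<^sup>2"
    "e\<^sub>p \<in> B" "e\<^sub>p \<notin> U" "r e\<^sub>p = (sin (max_angle U V))\<^sup>2"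
    "0 < (sin (friedrichs_angle U V))\<^sup>2"
proof -
  let ?T = "alt_proj U V"
  obtain B where B: "finite B" "pairwise orthogonal B" "span B = V"
      and B': "\<forall>b\<in>B. norm b = 1 \<and> ?T b = (?T b \<bullet> b) *\<^sub>R b"
    using selfadjoint_eigenbasis[OF V linear_alt_proj[OF U V] alt_proj_in[OF V]
        alt_proj_selfadjoint[OF U V]] by blast
  define l where "l b = ?T b \<bullet> b" for b
  have n1: "norm b = 1" and eig: "?T b = l b *\<^sub>R b" if "b \<in> B" for b
    using B' that by (auto simp: l_def)
  have BV: "B \<subseteq> V" using B(3) span_superset by blast
  have l0: "0 \<le> l b" if "b \<in> B" for b
    unfolding l_def using alt_proj_inner[OF U V, of b b] that BV by auto
  have l1: "l b \<le> 1" if "b \<in> B" for b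
  proof -
    have "b \<bullet> b = 1" using n1[OF that] by (simp add: norm_eq_1)
    then have "1 - l b = (proj_dist b U)\<^sup>2"
      using inner_alt_proj_residual[OF U V, of b] that BV eig[OF that]
      by (auto simp: inner_diff_right)
    then show ?thesis by (metis diff_ge_0_iff_ge zero_le_power2)
  qed
  have lU: "l b = 1 \<longleftrightarrow> b \<in> U" if "b \<in> B" for b
  proof -
    have "b \<noteq> 0" using n1[OF that] by auto
    then have "l b = 1 \<longleftrightarrow> ?T b = b"
      unfolding eig[OF that] using scaleR_cancel_right[of "l b" b 1] by simp
    then show ?thesis using alt_proj_fixed_iff[OF U V, of b] that BV by blast
  qed
  have ind: "independent B" using orthonormal_independent B(2) n1 by blast
  \<comment> \<open>The vectors of \<open>C\<close> span \<open>U \<inter> V\<close>, and \<open>K\<close> lists the singular values below 1 in increasing order;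
    the Friedrichs angle belongs to its last entry, the largest angle to its first.\<close>
  define C where "C = {b \<in> B. l b = 1}"
  define D where "D = B - C"
  have fin: "finite C" "finite D" and BCD: "B = D \<union> C" "D \<inter> C = {}"
    using B(1) by (auto simp: C_def D_def)
  have "U \<inter> V = span C"
    using eigenspace_eq_span[OF linear_alt_proj[OF U V] alt_proj_selfadjoint[OF U V] B n1 eig, of 1]
      alt_proj_fixed_iff[OF U V] by (auto simp: C_def)
  then have dimUV: "dim (U \<inter> V) = card C"
    using dim_eq_card_independent[OF independent_mono[OF ind]] BCD by simp
  have dimV: "dim V = card C + card D"
    using dim_eq_card_independent[OF ind] B(3) card_Un_disjoint[OF fin(2,1) BCD(2)] BCD(1)
    by (metis add.commute dim_span)
  have "D \<noteq> {}"
  proof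
    assume "D = {}"
    then have "V = U \<inter> V" using BCD B(3) \<open>U \<inter> V = span C\<close> by simp
    then show False using VU by blast
  qed
  define N where "N = image_mset (\<lambda>b. sqrt (l b)) (mset_set D)"
  define K where "K = sorted_list_of_multiset N"
  have "image_mset (\<lambda>b. sqrt (l b)) (mset_set B)
      = N + image_mset (\<lambda>b. sqrt (l b)) (mset_set C)"
    using fin BCD by (simp add: N_def mset_set_Union)
  also have "image_mset (\<lambda>b. sqrt (l b)) (mset_set C) = image_mset (\<lambda>b. 1) (mset_set C)"
    by (rule image_mset_cong) (use fin in \<open>auto simp: C_def\<close>)
  also have "\<dots> = replicate_mset (card C) 1" by (simp add: image_mset_const_eq)
  finally have M: "image_mset (\<lambda>b. sqrt (l b)) (mset_set B) = N + replicate_mset (card C) 1" .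
  have "x \<le> 1" if "x \<in># N" for x
    using that l1 fin by (auto simp: N_def D_def)
  then have L: "singular_values V (orth_proj U) = replicate (card C) 1 @ rev K"
    using singular_values_eigenbasis[OF U V B n1 eig l0]
      sorted_list_of_multiset_plus_replicate[of N 1 "card C"]
    by (simp add: M K_def)
  have setK: "set K = (\<lambda>b. sqrt (l b)) ` D" using fin by (simp add: K_def N_def)
  have sK: "sorted K" by (simp add: K_def)
  have lenK: "length K = card D"
    by (metis K_def N_def mset_sorted_list_of_multiset size_image_mset size_mset size_mset_set)
  have K0: "K \<noteq> []" using setK \<open>D \<noteq> {}\<close> by auto
  have F: "friedrichs_angle U V = arccos (last K)"
    using K0 by (simp add: friedrichs_angle_def principal_angle_def L dimUV nth_append
        hd_conv_nth[symmetric] hd_rev)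
  have "dim V - 1 = card C + (length K - 1)" using dimV lenK K0 by (cases K) auto
  then have "singular_values V (orth_proj U) ! (dim V - 1) = rev K ! (length K - 1)"
    by (simp add: L nth_append)
  also have "\<dots> = hd K" using K0 by (simp add: rev_nth hd_conv_nth)
  finally have "singular_values V (orth_proj U) ! (dim V - 1) = hd K" .
  then have P: "max_angle U V = arccos (hd K)"
    by (simp add: max_angle_def principal_angle_def)
  have bnd: "hd K \<le> x \<and> x \<le> last K" if x: "x \<in> set K" for x
  proof -
    obtain i where "i < length K" "x = K ! i" using x by (auto simp: in_set_conv_nth)
    then show ?thesis
      using sK K0 by (simp add: hd_conv_nth last_conv_nth sorted_nth_mono)
  qed
  have sin2: "(sin (arccos x))\<^sup>2 = 1 - x\<^sup>2" and x01: "0 \<le> x" "x \<le> 1" if "x \<in> set K" for x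
  proof -
    show "0 \<le> x" "x \<le> 1" using that setK l0 l1 by (auto simp: D_def)
    then show "(sin (arccos x))\<^sup>2 = 1 - x\<^sup>2"
      by (simp add: sin_arccos power_le_one_iff)
  qed
  have hl: "hd K \<in> set K" "last K \<in> set K" using K0 by auto
  obtain e\<^sub>F e\<^sub>p where e: "e\<^sub>F \<in> D" "last K = sqrt (l e\<^sub>F)" "e\<^sub>p \<in> D" "hd K = sqrt (l e\<^sub>p)"
    using hl setK by auto
  have DB: "b \<in> B" "b \<notin> U" "l b < 1" if "b \<in> D" for b
    using that lU l1[of b] by (auto simp: D_def C_def order_less_le)
  have sF: "(sin (friedrichs_angle U V))\<^sup>2 = 1 - l e\<^sub>F"
    and sp: "(sin (max_angle U V))\<^sup>2 = 1 - l e\<^sub>p"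
    using sin2[OF hl(1)] sin2[OF hl(2)] e l0 DB by (auto simp: F P)
  show thesis
  proof (rule that[of B "\<lambda>b. 1 - l b" e\<^sub>F e\<^sub>p])
    show "alt_proj U V b = b - (1 - l b) *\<^sub>R b" if "b \<in> B" for b
      using eig[OF that] by (simp add: algebra_simps)
    show "(sin (friedrichs_angle U V))\<^sup>2 \<le> 1 - l b \<and> 1 - l b \<le> (sin (max_angle U V))\<^sup>2"
      if "b \<in> B" "b \<notin> U" for b
    proof -
      have "b \<in> D" using that lU by (auto simp: D_def C_def)
      then have "sqrt (l e\<^sub>p) \<le> sqrt (l b)" "sqrt (l b) \<le> sqrt (l e\<^sub>F)"
        using bnd[of "sqrt (l b)"] setK e by auto
      then show ?thesis by (simp add: sF sp)
    qed
  qed (use B n1 e DB sF sp in auto)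
qed

section \<open>The two error bounds\<close>

text \<open>In the span of unit eigenvectors \<open>e\<^sub>F\<close>, \<open>e\<^sub>p\<close> (\<open>e\<close>, \<open>f\<close> below), with \<open>A = Id - T\<close> and eigenvalues \<open>a < b\<close>, the vector
  \<open>w = \<surd>b e\<^sub>F + \<surd>a e\<^sub>p\<close> is the equality case of the Kantorovich inequality: it maximises the angle
  between \<open>w\<close> and \<open>A w\<close>. No step along the line through \<open>w\<close> in direction \<open>A w\<close> can come closer to 0
  than \<open>(b - a) / (b + a) \<parallel>w\<parallel>\<close>. For \<open>a = b\<close>, where \<open>e\<^sub>F\<close> and \<open>e\<^sub>p\<close> may coincide, this bound is 0.\<close>

lemma kantorovich_extremal_vector:
  fixes T :: "'a::euclidean_space \<Rightarrow> 'a"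
  assumes T: "linear T" and a: "0 < a" and b: "a \<le> b"
    and e: "norm e = 1" "T e = e - a *\<^sub>R e" and f: "norm f = 1" "T f = f - b *\<^sub>R f"
    and ef: "a < b \<Longrightarrow> e \<bullet> f = 0"
  obtains w where "w \<in> span {e, f}" "w \<noteq> 0"
    "\<And>t. (b - a) / (b + a) * norm w \<le> norm (w + t *\<^sub>R (T w - w))"
proof (cases "a = b")
  case True
  show thesis
  proof (rule that[of e])
    show "e \<noteq> 0" using e by auto
  qed (auto simp: True span_base)
next
  case False
  then have ef0: "e \<bullet> f = 0" "f \<bullet> e = 0" using ef b by (auto simp: inner_commute)
  have one: "e \<bullet> e = 1" "f \<bullet> f = 1" using e f by (simp_all add: norm_eq_1)
  have comb: "(norm (x *\<^sub>R e + y *\<^sub>R f))\<^sup>2 = x\<^sup>2 + y\<^sup>2" for x y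
    unfolding power2_norm_eq_inner
    by (simp add: inner_add_left inner_add_right ef0 one power2_eq_square)
  let ?w = "sqrt b *\<^sub>R e + sqrt a *\<^sub>R f"
  have w2: "(norm ?w)\<^sup>2 = b + a" using a b by (simp add: comb)
  show thesis
  proof (rule that[of ?w])
    show "?w \<in> span {e, f}" by (intro span_add span_scale span_base) auto
    show "?w \<noteq> 0"
    proof
      assume "?w = 0"
      then have "(norm ?w)\<^sup>2 = 0" by (simp only: norm_zero) simp
      then show False using w2 a b by linarith
    qed
    fix t
    have "?w + t *\<^sub>R (T ?w - ?w) = (sqrt b * (1 - t * a)) *\<^sub>R e + (sqrt a * (1 - t * b)) *\<^sub>R f"
      by (simp add: linear_add[OF T] linear_scale[OF T] e f algebra_simps)
    then have n2: "(norm (?w + t *\<^sub>R (T ?w - ?w)))\<^sup>2 = b * (1 - t * a)\<^sup>2 + a * (1 - t * b)\<^sup>2"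
      using a b by (simp only: comb) (simp add: power_mult_distrib)
    \<comment> \<open>Completing the square in \<open>t\<close>: the minimum is at \<open>t = 2 / (a + b)\<close>.\<close>
    have "(b + a) * (b * (1 - t * a)\<^sup>2 + a * (1 - t * b)\<^sup>2)
        = (b - a)\<^sup>2 + a * b * (t * (b + a) - 2)\<^sup>2"
      by (simp add: power2_eq_square algebra_simps)
    then have "(b - a)\<^sup>2 \<le> (b + a) * (b * (1 - t * a)\<^sup>2 + a * (1 - t * b)\<^sup>2)"
      using a b by simp
    then have "(b - a)\<^sup>2 / (b + a) \<le> b * (1 - t * a)\<^sup>2 + a * (1 - t * b)\<^sup>2"
      using a b by (simp add: divide_le_eq mult.commute)
    moreover have "((b - a) / (b + a) * norm ?w)\<^sup>2 = (b - a)\<^sup>2 / (b + a)"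
      using a b unfolding power_mult_distrib w2 by (simp add: power2_eq_square)
    ultimately have "((b - a) / (b + a) * norm ?w)\<^sup>2 \<le> (norm (?w + t *\<^sub>R (T ?w - ?w)))\<^sup>2"
      by (simp only: n2)
    then show "(b - a) / (b + a) * norm ?w \<le> norm (?w + t *\<^sub>R (T ?w - ?w))"
      by (rule power2_le_imp_le) simp
  qed
qed

text \<open>The fixed step \<open>2 / (a + b)\<close> maps every eigenvalue \<open>x \<in> [a, b]\<close> of \<open>Id - T\<close> to
  \<open>1 - 2 x / (a + b)\<close>, whose modulus is largest at the two ends of the interval.\<close>

lemma relaxed_step_contraction:
  fixes T :: "'a::euclidean_space \<Rightarrow> 'a"
  assumes T: "linear T" and a: "0 < a" and ab: "a \<le> b"
    and B: "finite B" "pairwise orthogonal B" "\<And>v. v \<in> B \<Longrightarrow> norm v = 1" "w \<in> span B"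
    and eig: "\<And>v. v \<in> B \<Longrightarrow> T v = v - r v *\<^sub>R v"
    and spec: "\<And>v. v \<in> B \<Longrightarrow> w \<bullet> v \<noteq> 0 \<Longrightarrow> a \<le> r v \<and> r v \<le> b"
  shows "norm (w + (2 / (a + b)) *\<^sub>R (T w - w)) \<le> (b - a) / (b + a) * norm w"
proof -
  let ?t = "2 / (a + b)"
  have orth: "pairwise (\<lambda>i j. orthogonal (c i *\<^sub>R i) (c j *\<^sub>R j)) B" for c :: "'a \<Rightarrow> real"
    using B(2) by (auto simp: pairwise_def orthogonal_def)
  have norm2: "(norm (\<Sum>v\<in>B. c v *\<^sub>R v))\<^sup>2 = (\<Sum>v\<in>B. (c v)\<^sup>2)" for c :: "'a \<Rightarrow> real"
    using norm_sum_Pythagorean[OF B(1) orth, of c] B(3) by simp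
  have w: "(\<Sum>v\<in>B. (w \<bullet> v) *\<^sub>R v) = w"
    using orthonormal_basis_expand[OF B(2,3,4,1)] by simp
  have "T w = T (\<Sum>v\<in>B. (w \<bullet> v) *\<^sub>R v)" by (simp only: w)
  also have "\<dots> = (\<Sum>v\<in>B. (w \<bullet> v) *\<^sub>R T v)"
    by (simp add: linear_sum[OF T] linear_scale[OF T])
  also have "\<dots> = (\<Sum>v\<in>B. (w \<bullet> v) *\<^sub>R v - (r v * (w \<bullet> v)) *\<^sub>R v)"
    by (rule sum.cong) (auto simp: eig algebra_simps)
  also have "\<dots> = w - (\<Sum>v\<in>B. (r v * (w \<bullet> v)) *\<^sub>R v)"
    by (simp only: sum_subtractf w)
  finally have "w + ?t *\<^sub>R (T w - w) = (\<Sum>v\<in>B. (w \<bullet> v) *\<^sub>R v) - ?t *\<^sub>R (\<Sum>v\<in>B. (r v * (w \<bullet> v)) *\<^sub>R v)"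
    by (simp add: w)
  also have "\<dots> = (\<Sum>v\<in>B. ((1 - ?t * r v) * (w \<bullet> v)) *\<^sub>R v)"
    by (simp add: scaleR_sum_right sum_subtractf[symmetric] left_diff_distrib
        scaleR_left_diff_distrib mult.assoc)
  finally have "(norm (w + ?t *\<^sub>R (T w - w)))\<^sup>2 = (\<Sum>v\<in>B. ((1 - ?t * r v) * (w \<bullet> v))\<^sup>2)"
    by (simp only: norm2)
  also have "\<dots> \<le> (\<Sum>v\<in>B. ((b - a) / (b + a))\<^sup>2 * (w \<bullet> v)\<^sup>2)"
  proof (rule sum_mono)
    fix v assume v: "v \<in> B"
    show "((1 - ?t * r v) * (w \<bullet> v))\<^sup>2 \<le> ((b - a) / (b + a))\<^sup>2 * (w \<bullet> v)\<^sup>2"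
    proof (cases "w \<bullet> v = 0")
      case False
      have "1 - ?t * r v = (a + b - 2 * r v) / (b + a)"
        using a ab by (simp add: field_simps)
      then have "\<bar>1 - ?t * r v\<bar> \<le> \<bar>(b - a) / (b + a)\<bar>"
        using spec[OF v False] a ab by (simp only: abs_divide) (intro divide_right_mono, auto)
      then have "(1 - ?t * r v)\<^sup>2 \<le> ((b - a) / (b + a))\<^sup>2" by (rule abs_le_square_iff[THEN iffD1])
      then show ?thesis unfolding power_mult_distrib by (rule mult_right_mono) simp
    qed simp
  qed
  also have "\<dots> = ((b - a) / (b + a) * norm w)\<^sup>2"
    using norm2[of "\<lambda>v. w \<bullet> v"] by (simp only: w sum_distrib_left[symmetric] power_mult_distrib)
  finally show ?thesis
    by (rule power2_le_imp_le) (use a ab in simp)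
qed

section \<open>The circumcenter step\<close>

text \<open>A point of the affine hull that is equidistant from all the points is the circumcenter: the
  difference of two equidistant points is orthogonal to the affine hull.\<close>

lemma circumcenter_eqI:
  assumes y: "y \<in> affine hull S" and eqd: "\<And>x x'. x \<in> S \<Longrightarrow> x' \<in> S \<Longrightarrow> dist y x = dist y x'"
  shows "circumcenter S = y"
proof -
  define q where "q = (SOME q. \<forall>x\<in>S. \<forall>y\<in>S. dist q x = dist q y)"
  have q: "dist q x = dist q x'" if "x \<in> S" "x' \<in> S" for x x'
  proof -
    have "\<exists>q. \<forall>x\<in>S. \<forall>x'\<in>S. dist q x = dist q x'" using eqd by blast
    then have "\<forall>x\<in>S. \<forall>x'\<in>S. dist q x = dist q x'" unfolding q_def by (rule someI_ex)
    then show ?thesis using that by blast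
  qed
  have "S \<noteq> {}" using y by auto
  then obtain x0 where x0: "x0 \<in> S" by blast
  let ?H = "{x. (q - y) \<bullet> x = (q - y) \<bullet> x0}"
  have "S \<subseteq> ?H"
  proof clarify
    fix x assume x: "x \<in> S"
    have "(dist q x)\<^sup>2 = (dist q x0)\<^sup>2" "(dist y x)\<^sup>2 = (dist y x0)\<^sup>2"
      using q eqd x x0 by metis+
    then show "(q - y) \<bullet> x = (q - y) \<bullet> x0"
      by (simp add: dist_norm power2_norm_eq_inner inner_diff_left inner_diff_right inner_commute)
  qed
  then have H: "affine hull S \<subseteq> ?H" by (rule hull_minimal) (rule affine_hyperplane)
  have "orth_proj (affine hull S) q = y"
    using y H by (intro orth_proj_eqI) (auto simp: inner_diff_right subset_iff)
  then show ?thesis by (simp add: circumcenter_def q_def)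
qed

text \<open>With \<open>y = T v\<close> and \<open>q\<close> the projection of \<open>v\<close> onto \<open>U \<inter> V\<close>, the point of the line through \<open>v\<close> and \<open>y\<close>
  nearest to \<open>q\<close> has the parameter \<open>\<langle>v - q, v - y\<rangle> / \<parallel>v - y\<parallel>\<^sup>2\<close>. Here \<open>\<langle>q, v - y\<rangle> = 0\<close>, so the numerator
  can be computed from \<open>v\<close> and \<open>y\<close> alone. At a point of \<open>U \<inter> V\<close> the denominator is 0, and the quotient
  takes the required value 0.\<close>

definition line_search_step :: "'a::euclidean_space \<Rightarrow> 'a \<Rightarrow> real" where
  "line_search_step v y = (v \<bullet> (v - y)) / (norm (v - y))\<^sup>2"

lemma line_search_step_mult:
  assumes "v = y \<Longrightarrow> v \<bullet> (v - y) = 0"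
  shows "line_search_step v y * (norm (v - y))\<^sup>2 = v \<bullet> (v - y)"
  using assms by (cases "v = y") (auto simp: line_search_step_def)

text \<open>With \<open>d = v - T v\<close>, the midpoint of the two reflected points is \<open>P\<^sub>V R\<^sub>U v = v - 2 d\<close>, so the line
  \<open>v + \<real> d\<close> lies in the affine hull. All its points are in \<open>V\<close>, hence equidistant from \<open>R\<^sub>U v\<close> and its
  mirror image in \<open>V\<close>; equidistance from \<open>v\<close> and \<open>R\<^sub>U v\<close> selects the line-search point.\<close>

lemma circ_map_eq_step_map:
  assumes U: "subspace U" and V: "subspace V" and v: "v \<in> V"
  shows "circ_map U V v = step_map U V (\<lambda>v. line_search_step v (alt_proj U V v)) v"
proof -
  define p where "p = orth_proj U v"
  define d where "d = v - alt_proj U V v"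
  define c where "c = line_search_step v (alt_proj U V v)"
  define x1 where "x1 = orth_refl U v"
  define x2 where "x2 = orth_refl V x1"
  have x1: "x1 = 2 *\<^sub>R p - v" by (simp add: x1_def p_def orth_refl_def)
  have "orth_proj V x1 = v - 2 *\<^sub>R d"
    unfolding x1 by (simp add: linear_diff[OF linear_orth_proj[OF V]]
        linear_add[OF linear_orth_proj[OF V]] orth_proj_id[OF V v] d_def alt_proj_def p_def
        scaleR_right_diff_distrib scaleR_2)
  then have x2: "x2 = 2 *\<^sub>R (v - 2 *\<^sub>R d) - x1" by (simp add: x2_def orth_refl_def)
  define y where "y = v - c *\<^sub>R d"
  have dV: "d \<in> V" using v alt_proj_in[OF V] V by (simp add: d_def subspace_diff)
  have vd: "v \<bullet> d = (v - p) \<bullet> (v - p)"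
    using inner_alt_proj_residual[OF U V v]
    by (simp add: d_def p_def proj_dist_def power2_norm_eq_inner)
  have cd: "c * (d \<bullet> d) = v \<bullet> d"
    using line_search_step_mult[of v "alt_proj U V v"]
    by (simp add: c_def d_def power2_norm_eq_inner)
  have pd: "p \<bullet> d = (v - d) \<bullet> d"
    using orth_proj_inner[OF V dV, of p] by (simp add: d_def p_def alt_proj_def)
  have "(dist y x1)\<^sup>2 = (dist y v)\<^sup>2"
  proof -
    have "(dist y x1)\<^sup>2 - (dist y v)\<^sup>2 = 4 * ((v - p) \<bullet> (v - p) - c * (v \<bullet> d - p \<bullet> d))"
      unfolding dist_norm power2_norm_eq_inner y_def x1
      by (simp add: inner_diff_left inner_diff_right inner_commute algebra_simps)
    also have "\<dots> = 0" using vd cd pd by (simp add: inner_diff_left)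
    finally show ?thesis by simp
  qed
  then have d1: "dist y x1 = dist y v" by simp
  have "(dist y x2)\<^sup>2 = (dist y x1)\<^sup>2"
  proof -
    have "y \<in> V" using v dV V by (simp add: y_def subspace_diff subspace_scale)
    then have "(y - (v - 2 *\<^sub>R d)) \<in> V" using v dV V by (simp add: subspace_diff subspace_scale)
    then have "(x1 - (v - 2 *\<^sub>R d)) \<bullet> (y - (v - 2 *\<^sub>R d)) = 0"
      using orth_proj_residual[OF V] \<open>orth_proj V x1 = v - 2 *\<^sub>R d\<close> by metis
    moreover have "y - x2 = (y - (v - 2 *\<^sub>R d)) + (x1 - (v - 2 *\<^sub>R d))"
      "y - x1 = (y - (v - 2 *\<^sub>R d)) - (x1 - (v - 2 *\<^sub>R d))"
      by (simp_all add: x2 scaleR_2)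
    ultimately show ?thesis
      by (simp only: dist_norm power2_norm_eq_inner inner_add_left inner_add_right
          inner_diff_left[of "y - _"] inner_diff_right[of _ "y - _"]) (simp add: inner_commute)
  qed
  then have d2: "dist y x2 = dist y x1" by simp
  have "y = (1 - c / 2) *\<^sub>R v + (c / 4) *\<^sub>R x1 + (c / 4) *\<^sub>R x2"
  proof -
    have "(c / 4) *\<^sub>R x1 + (c / 4) *\<^sub>R x2 = (c / 2) *\<^sub>R (v - 2 *\<^sub>R d)"
      by (simp add: x2 scaleR_right_diff_distrib)
    then show ?thesis by (simp add: y_def algebra_simps)
  qed
  then have "y \<in> affine hull {v, x1, x2}"
    unfolding affine_hull_3 by (intro CollectI exI[of _ "1 - c / 2"] exI[of _ "c / 4"]) auto
  then have "circumcenter {v, x1, x2} = y"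
    using d1 d2 by (intro circumcenter_eqI) auto
  moreover have "y = step_map U V (\<lambda>v. line_search_step v (alt_proj U V v)) v"
    by (simp add: y_def d_def c_def step_map_def algebra_simps)
  ultimately show ?thesis by (simp add: circ_map_def x1_def x2_def)
qed

lemma step_size_line_search:
  assumes U: "subspace U" and V: "subspace V"
  shows "step_size U V (\<lambda>v. line_search_step v (alt_proj U V v))"
proof -
  have "continuous_on UNIV (alt_proj U V)"
    using linear_alt_proj[OF assms] by (simp add: linear_continuous_on linear_conv_bounded_linear)
  then have [measurable]: "alt_proj U V \<in> borel_measurable borel"
    by (rule borel_measurable_continuous_onI)
  have "(\<lambda>v. line_search_step v (alt_proj U V v)) \<in> borel_measurable borel"
    unfolding line_search_step_def by measurable
  then show ?thesis
    using alt_proj_fixed_iff[OF assms]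
    by (fastforce simp: step_size_def measurable_restrict_space1 line_search_step_def)
qed

lemma parameter_free_circ_map:
  "parameter_free_method (circ_map :: 'a::euclidean_space set \<Rightarrow> 'a set \<Rightarrow> 'a \<Rightarrow> 'a)"
proof -
  define F :: "'a \<times> 'a \<times> 'a \<times> 'a \<times> real \<times> real \<times> real \<Rightarrow> real"
    where "F = (\<lambda>(v, pu, pv, t, _). line_search_step v t)"
  have "F (iterate_data U V v) = line_search_step v (alt_proj U V v)" for U V v
    by (simp add: F_def iterate_data_def)
  then show ?thesis
    unfolding parameter_free_method_def
    by (intro exI[of _ F]) (simp add: step_size_line_search circ_map_eq_step_map)
qed

lemma norm_line_search_le:
  fixes w d :: "'a::real_inner"
  assumes "c * (norm d)\<^sup>2 = w \<bullet> d"
  shows "norm (w - c *\<^sub>R d) \<le> norm (w - t *\<^sub>R d)"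
proof (rule power2_le_imp_le)
  have "(norm (w - t *\<^sub>R d))\<^sup>2 - (norm (w - c *\<^sub>R d))\<^sup>2 = (t - c)\<^sup>2 * (d \<bullet> d)"
    unfolding power2_norm_eq_inner
    by (simp add: inner_diff_left inner_diff_right inner_commute[of d w]
        assms[unfolded power2_norm_eq_inner, symmetric])
       (simp add: power2_eq_square algebra_simps)
  also have "\<dots> \<ge> 0" by simp
  finally show "(norm (w - c *\<^sub>R d))\<^sup>2 \<le> (norm (w - t *\<^sub>R d))\<^sup>2" by simp
qed simp

section \<open>Optimality\<close>

text \<open>The extremal vector \<open>w\<close> is orthogonal to \<open>U \<inter> V\<close>, so it is its own error, and the bound for every
  scalar \<open>t\<close> covers the value \<open>c w\<close>.\<close>

lemma worst_rate_step_map_ge: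
  assumes U: "subspace U" and V: "subspace V" and VU: "\<not> V \<subseteq> U"
  shows "ereal (rho_V U V) \<le> worst_rate U V (step_map U V c)"
proof -
  define a where "a = (sin (friedrichs_angle U V))\<^sup>2"
  define b where "b = (sin (max_angle U V))\<^sup>2"
  obtain B r e f where B: "finite B" "pairwise orthogonal B" "span B = V"
      "\<And>x. x \<in> B \<Longrightarrow> norm x = 1"
      and eig: "\<And>x. x \<in> B \<Longrightarrow> alt_proj U V x = x - r x *\<^sub>R x"
      and spec: "\<And>x. x \<in> B \<Longrightarrow> x \<notin> U \<Longrightarrow> a \<le> r x \<and> r x \<le> b"
      and ef: "e \<in> B" "e \<notin> U" "r e = a" "f \<in> B" "f \<notin> U" "r f = b" and a0: "0 < a"
    by (rule principal_eigenbasis[OF assms, folded a_def b_def]) blast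
  have ab: "a \<le> b" using spec[OF ef(1,2)] ef by auto
  have efV: "e \<in> V" "f \<in> V" using ef B(3) span_base by blast+
  have "e \<bullet> f = 0" if "a < b"
  proof -
    have "e \<noteq> f" using that ef by auto
    then show ?thesis using B(2) ef by (auto simp: pairwise_def orthogonal_def)
  qed
  then obtain w where w: "w \<in> span {e, f}" "w \<noteq> 0"
    "\<And>t. (b - a) / (b + a) * norm w \<le> norm (w + t *\<^sub>R (alt_proj U V w - w))"
    using kantorovich_extremal_vector[OF linear_alt_proj[OF U V] a0 ab, of e f] B(4) eig ef by metis
  have wV: "w \<in> V" using w(1) efV V by (metis empty_subsetI insert_subset span_minimal subsetD)
  \<comment> \<open>Eigenvectors for nonzero eigenvalues of \<open>Id - T\<close> are orthogonal to its kernel \<open>U \<inter> V\<close>.\<close>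
  have perp: "x \<bullet> z = 0" if "x \<in> {e, f}" "z \<in> U \<inter> V" for x z
  proof -
    have x: "x \<in> V" "x \<in> B" "0 < r x" using that ef efV a0 ab by auto
    have "alt_proj U V x \<bullet> z = x \<bullet> alt_proj U V z"
      using alt_proj_selfadjoint[OF U V] x that by blast
    then have "(1 - r x) * (x \<bullet> z) = x \<bullet> z"
      using alt_proj_fixed_iff[OF U V, of z] that eig[OF x(2)]
      by (simp add: inner_diff_left algebra_simps)
    then show ?thesis using x(3) by (simp add: algebra_simps)
  qed
  have "w \<bullet> z = 0" if "z \<in> U \<inter> V" for z
    using w(1)
  proof (induction rule: span_induct)
    case base
    then show ?case by (auto simp: subspace_def inner_add_left)
  next
    case (step x)
    then show ?case using perp that by blast
  qed
  then have P0: "orth_proj (U \<inter> V) w = 0"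
    using U V by (intro orth_proj_subspace_eqI) (auto simp: subspace_Int subspace_inter subspace_0)
  have "rho_V U V \<le> norm (step_map U V c w - 0) / norm (w - 0)"
    using w(2) w(3)[of "c w"] by (simp add: rho_V_def a_def b_def step_map_def pos_le_divide_eq)
  also have "ereal \<dots> \<le> worst_rate U V (step_map U V c)"
    unfolding worst_rate_def by (rule SUP_upper2[of w]) (use wV w(2) P0 in auto)
  finally show ?thesis by simp
qed

text \<open>Among all points of the line \<open>v + \<real> (T v - v)\<close> the circumcenter is the closest to the projection
  of \<open>v\<close> onto \<open>U \<inter> V\<close>, hence at least as close as the point reached by the fixed step \<open>2 / (a + b)\<close>.\<close>

lemma norm_circ_map_le:
  assumes U: "subspace U" and V: "subspace V" and VU: "\<not> V \<subseteq> U" and v: "v \<in> V"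
  shows "norm (circ_map U V v - orth_proj (U \<inter> V) v)
    \<le> rho_V U V * norm (v - orth_proj (U \<inter> V) v)"
proof -
  let ?T = "alt_proj U V"
  define a where "a = (sin (friedrichs_angle U V))\<^sup>2"
  define b where "b = (sin (max_angle U V))\<^sup>2"
  obtain B r e f where B: "finite B" "pairwise orthogonal B" "span B = V"
      "\<And>x. x \<in> B \<Longrightarrow> norm x = 1"
      and eig: "\<And>x. x \<in> B \<Longrightarrow> ?T x = x - r x *\<^sub>R x"
      and spec: "\<And>x. x \<in> B \<Longrightarrow> x \<notin> U \<Longrightarrow> a \<le> r x \<and> r x \<le> b"
      and ef: "e \<in> B" "e \<notin> U" "r e = a" "f \<in> B" "f \<notin> U" "r f = b" and a0: "0 < a"
    by (rule principal_eigenbasis[OF assms(1-3), folded a_def b_def]) blast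
  have ab: "a \<le> b" using spec[OF ef(1,2)] ef by auto
  have UV: "subspace (U \<inter> V)" using U V by (simp add: subspace_Int subspace_inter)
  define q where "q = orth_proj (U \<inter> V) v"
  define w where "w = v - q"
  define d where "d = v - ?T v"
  define c where "c = line_search_step v (?T v)"
  have q: "q \<in> U" "q \<in> V" using orth_proj_in[OF UV, of v] by (auto simp: q_def)
  have wV: "w \<in> V" using v q V by (simp add: w_def subspace_diff)
  have wperp: "w \<bullet> z = 0" if "z \<in> U \<inter> V" for z
    using orth_proj_residual[OF UV that] by (simp add: w_def q_def)
  have Tq: "?T q = q" using alt_proj_fixed_iff[OF U V] q by blast
  have d: "d = w - ?T w"
    using Tq by (simp add: d_def w_def linear_diff[OF linear_alt_proj[OF U V]])
  have "q \<bullet> d = 0"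
    using alt_proj_selfadjoint[OF U V q(2) v] Tq by (simp add: d_def inner_diff_right)
  then have "c * (norm d)\<^sup>2 = w \<bullet> d"
    using line_search_step_mult[of v "?T v"] by (simp add: c_def d_def w_def inner_diff_left)
  then have "norm (w - c *\<^sub>R d) \<le> norm (w - (2 / (a + b)) *\<^sub>R d)"
    by (rule norm_line_search_le)
  also have "\<dots> = norm (w + (2 / (a + b)) *\<^sub>R (?T w - w))"
    by (simp add: d algebra_simps)
  also have "\<dots> \<le> (b - a) / (b + a) * norm w"
  proof (rule relaxed_step_contraction[OF linear_alt_proj[OF U V] a0 ab B(1,2)])
    show "a \<le> r x \<and> r x \<le> b" if "x \<in> B" "w \<bullet> x \<noteq> 0" for x
      using that wperp spec B(3) span_base by blast
  qed (use B wV eig in auto)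
  finally have "norm (w - c *\<^sub>R d) \<le> rho_V U V * norm w"
    by (simp add: rho_V_def a_def b_def)
  moreover have "circ_map U V v - q = w - c *\<^sub>R d"
    unfolding circ_map_eq_step_map[OF U V v]
    by (simp add: step_map_def w_def d_def c_def algebra_simps)
  ultimately show ?thesis by (simp only: q_def[symmetric] w_def[symmetric])
qed

text \<open>The lower bound applies to the circumcenter map too, since on \<open>V\<close> it is a step map.\<close>

lemma worst_rate_circ_map:
  assumes U: "subspace U" and V: "subspace V" and VU: "\<not> V \<subseteq> U"
  shows "worst_rate U V (circ_map U V) = ereal (rho_V U V)"
proof (rule antisym)
  show "worst_rate U V (circ_map U V) \<le> ereal (rho_V U V)"
    unfolding worst_rate_def
    using norm_circ_map_le[OF assms] by (intro SUP_least) (simp add: pos_divide_le_eq)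
  have "worst_rate U V (circ_map U V)
      = worst_rate U V (step_map U V (\<lambda>v. line_search_step v (alt_proj U V v)))"
    unfolding worst_rate_def by (rule SUP_cong) (simp_all add: circ_map_eq_step_map[OF U V])
  then show "ereal (rho_V U V) \<le> worst_rate U V (circ_map U V)"
    using worst_rate_step_map_ge[OF assms] by simp
qed

theorem proposition6p6:
  fixes U V :: "(real ^ 'n) set"
  assumes "subspace U" and "subspace V" and "\<not> V \<subseteq> U"
  shows "(\<forall>c. step_size U V c \<longrightarrow> worst_rate U V (step_map U V c) \<ge> ereal (rho_V U V))
    \<and> worst_rate U V (circ_map U V) = ereal (rho_V U V)
    \<and> parameter_free_method (circ_map :: (real ^ 'n) set \<Rightarrow> (real ^ 'n) set \<Rightarrow> real ^ 'n \<Rightarrow> real ^ 'n)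
    \<and> (\<forall>c. step_size U V c \<longrightarrow> worst_rate U V (circ_map U V) \<le> worst_rate U V (step_map U V c))"
  using worst_rate_step_map_ge[OF assms] worst_rate_circ_map[OF assms] parameter_free_circ_map
  by simp

end
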